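(* Let $T:[0,1]\to\mathbb{R}$ be the Takagi function and, for $y\in[0,\frac23]$, let $L(y)=\{x\in[0,1]:T(x)=y\}$. (i) For each $m\in\mathbb{N}$, the set $S_{\le m}:=\{y\in[0,\frac23]:|L(y)|\le m\}$ is nowhere dense in $[0,\frac23]$. (ii) The set $S_\infty:=\{y\in[0,\frac23]:|L(y)|=\infty\}$ is residual in $[0,\frac23]$, and is $\mathbf{\Delta}^0_3$ in the Borel hierarchy.
   Context: The Takagi function is $T(x)=\sum_{n=0}^\infty 2^{-n}\phi(2^n x)$, where $\phi(x)=\operatorname{dist}(x,\mathbb{Z})$ is the distance from $x$ to the nearest integer. Its range on $[0,1]$ is $[0,\frac23]$. $|\cdot|$ denotes cardinality. Residual means having complement of first category (meager). $\mathbf{\Delta}^0_3$ means both $\mathbf{\Sigma}^0_3$ and $\mathbf{\Pi}^0_3$. *)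

theory Defs
  imports "HOL-Analysis.Analysis"
begin

section \<open>The Takagi function and its level sets\<close>

definition takagi_phi :: "real \<Rightarrow> real"
  where "takagi_phi x = infdist x \<int>"

definition takagi :: "real \<Rightarrow> real"
  where "takagi x = (\<Sum>n. takagi_phi (2 ^ n * x) / 2 ^ n)"

text \<open>The Takagi function is considered on the unit interval only, so this is where the level
  sets live.\<close>

definition takagi_level :: "real \<Rightarrow> real set"
  where "takagi_level y = {x \<in> {0..1}. takagi x = y}"

text \<open>Finiteness is stated separately because \<open>card\<close> of an infinite set is \<open>0\<close>.\<close>

definition takagi_S_le :: "nat \<Rightarrow> real set"
  where "takagi_S_le m =
    {y \<in> {0..2/3}. finite (takagi_level y) \<and> card (takagi_level y) \<le> m}"

definition takagi_S_inf :: "real set"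
  where "takagi_S_inf = {y \<in> {0..2/3}. infinite (takagi_level y)}"

section \<open>Baire category\<close>

definition nowhere_dense_in :: "'a topology \<Rightarrow> 'a set \<Rightarrow> bool"
  where "nowhere_dense_in X S \<longleftrightarrow> S \<subseteq> topspace X \<and> X interior_of (X closure_of S) = {}"

definition first_category_in :: "'a topology \<Rightarrow> 'a set \<Rightarrow> bool"
  where "first_category_in X S \<longleftrightarrow>
    (\<exists>\<N>. countable \<N> \<and> (\<forall>N\<in>\<N>. nowhere_dense_in X N) \<and> S = \<Union>\<N>)"

definition residual_in :: "'a topology \<Rightarrow> 'a set \<Rightarrow> bool"
  where "residual_in X S \<longleftrightarrow> S \<subseteq> topspace X \<and> first_category_in X (topspace X - S)"

section \<open>The finite levels of the Borel hierarchy\<close>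

text \<open>Levels are numbered from 1 as usual: the first \<open>\<Sigma>\<close> class consists of the open sets, each \<open>\<Pi>\<close>
  class consists of the complements of the corresponding \<open>\<Sigma>\<close> class, and for \<open>n \<ge> 2\<close> the \<open>\<Sigma>\<close> class of
  level \<open>n\<close> consists of the countable unions of sets from \<open>\<Pi>\<close> classes of lower level. The rules
  derive nothing at level \<open>0\<close>, so in the rule \<open>union\<close> necessarily \<open>1 \<le> m k < n\<close>.\<close>

inductive borel_Sigma0 :: "'a topology \<Rightarrow> nat \<Rightarrow> 'a set \<Rightarrow> bool"
  and borel_Pi0 :: "'a topology \<Rightarrow> nat \<Rightarrow> 'a set \<Rightarrow> bool"
  for X :: "'a topology"
where
  "open": "openin X S \<Longrightarrow> borel_Sigma0 X 1 S"
| union: "(\<And>k::nat. m k < n \<and> borel_Pi0 X (m k) (A k)) \<Longrightarrow> borel_Sigma0 X n (\<Union>k. A k)"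
| compl: "borel_Sigma0 X n S \<Longrightarrow> borel_Pi0 X n (topspace X - S)"

definition borel_Delta0 :: "'a topology \<Rightarrow> nat \<Rightarrow> 'a set \<Rightarrow> bool"
  where "borel_Delta0 X n S \<longleftrightarrow> borel_Sigma0 X n S \<and> borel_Pi0 X n S"

end

theory Submission
  imports Defs
begin

text \<open>On a dyadic cell of order \<open>n\<close> the function is an affine function plus a copy of itself shrunk by
  \<open>2 ^ n\<close>. Cells on which the affine part is constant carry humps, which are similar to the whole
  graph. The level set of \<open>y\<close> is infinite iff \<open>y\<close> is attained on infinitely many humps: a hump is
  symmetric, so points on ever smaller humps have further points of the level set nearby, while away
  from the humps the function is strictly monotone on each cell. Hence the set of these \<open>y\<close> is the
  limit superior of a sequence of finite unions of compact intervals, which is \<open>\<Pi>\<close> of level 3;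
  passing to the interiors gives a \<open>G\<close>-delta set and loses only countably many points, so it is
  also \<open>\<Sigma>\<close> of level 3. For the category statements, every nonempty open set of ordinates contains
  the range of a hump, which contains an interval of ordinates attained at least \<open>2 ^ m\<close> times.\<close>

subsection \<open>Functional equations\<close>

lemma takagi_phi_eq_round: "takagi_phi x = \<bar>x - of_int (round x)\<bar>"
proof (rule antisym)
  show "takagi_phi x \<le> \<bar>x - of_int (round x)\<bar>"
    unfolding takagi_phi_def using infdist_le[of "of_int (round x)" \<int> x] by (simp add: dist_real_def)
  have "(\<int>::real set) \<noteq> {}" using Ints_0 by blast
  then show "\<bar>x - of_int (round x)\<bar> \<le> takagi_phi x"
    unfolding takagi_phi_def
    by (subst infdist_notempty, assumption, intro cINF_greatest)
      (auto elim!: Ints_cases simp: dist_real_def round_diff_minimal)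
qed

lemma takagi_phi_nonneg: "0 \<le> takagi_phi x"
  by (simp add: takagi_phi_eq_round)

lemma takagi_phi_le_half: "takagi_phi x \<le> 1 / 2"
  using of_int_round_abs_le[of x] by (simp add: takagi_phi_eq_round abs_minus_commute)

lemma takagi_phi_le: "takagi_phi x \<le> \<bar>x - of_int m\<bar>"
  by (simp add: takagi_phi_eq_round round_diff_minimal)

lemma takagi_phi_add_int: "takagi_phi (x + of_int m) = takagi_phi x"
proof (rule antisym)
  show "takagi_phi (x + of_int m) \<le> takagi_phi x"
    using takagi_phi_le[of "x + of_int m" "round x + m"] by (simp add: takagi_phi_eq_round[of x])
  show "takagi_phi x \<le> takagi_phi (x + of_int m)"
    using takagi_phi_le[of x "round (x + of_int m) - m"]
    by (simp add: takagi_phi_eq_round[of "x + of_int m"] algebra_simps)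
qed

lemma takagi_phi_minus: "takagi_phi (- x) = takagi_phi x"
proof -
  have "takagi_phi (- z) \<le> takagi_phi z" for z
    using takagi_phi_le[of "- z" "- round z"] by (simp add: takagi_phi_eq_round[of z] abs_minus_commute)
  from this[of x] this[of "- x"] show ?thesis by simp
qed

lemma takagi_phi_id:
  assumes "0 \<le> x" "x \<le> 1 / 2"
  shows "takagi_phi x = x"
proof (rule antisym)
  show "takagi_phi x \<le> x" using takagi_phi_le[of x 0] assms by simp
  have "x \<le> \<bar>x - of_int m\<bar>" for m :: int
  proof (cases "m \<le> 0")
    case True
    then have "(of_int m :: real) \<le> 0" by simp
    then show ?thesis using assms by linarith
  next
    case False
    then have "(of_int m :: real) \<ge> 1" by simp
    then show ?thesis using assms by linarith
  qed
  then show "x \<le> takagi_phi x" by (simp add: takagi_phi_eq_round)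
qed

section \<open>Convergence, bounds and continuity of the series\<close>

lemma takagi_term_bound: "norm (takagi_phi (2 ^ n * x) / 2 ^ n) \<le> (1 / 2) ^ n / 2"
  using takagi_phi_le_half[of "2 ^ n * x"] takagi_phi_nonneg[of "2 ^ n * x"]
  by (simp add: power_divide field_simps)

lemma sums_takagi_bound: "(\<lambda>n. (1 / 2) ^ n / 2 :: real) sums 1"
  using sums_divide[OF geometric_sums[of "1 / 2 :: real"], of 2] by simp

lemma summable_takagi: "summable (\<lambda>n. takagi_phi (2 ^ n * x) / 2 ^ n)"
  by (rule summable_comparison_test'[OF sums_summable[OF sums_takagi_bound]]) (rule takagi_term_bound)

lemma takagi_nonneg: "0 \<le> takagi x"
  unfolding takagi_def by (intro suminf_nonneg summable_takagi) (simp add: takagi_phi_nonneg)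

text \<open>Crude, since the maximum is 2/3; it supplies the error term in
  \<open>takagi_le_right_end_approx\<close>.\<close>

lemma takagi_le_1: "takagi x \<le> 1"
proof -
  have "takagi x \<le> (\<Sum>n. (1 / 2) ^ n / 2)"
    unfolding takagi_def
    by (intro suminf_le summable_takagi sums_summable[OF sums_takagi_bound]
        order.trans[OF abs_ge_self takagi_term_bound[unfolded real_norm_def]])
  also have "\<dots> = 1" using sums_takagi_bound by (rule sums_unique[symmetric])
  finally show ?thesis .
qed

lemma continuous_on_takagi: "continuous_on A takagi"
proof -
  have "uniform_limit UNIV (\<lambda>n x. \<Sum>i<n. takagi_phi (2 ^ i * x) / 2 ^ i)
      (\<lambda>x. \<Sum>i. takagi_phi (2 ^ i * x) / 2 ^ i) sequentially"
    by (rule Weierstrass_m_test[OF takagi_term_bound sums_summable[OF sums_takagi_bound]])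
  then have "continuous_on UNIV (\<lambda>x. \<Sum>i. takagi_phi (2 ^ i * x) / 2 ^ i)"
    by (rule uniform_limit_theorem[rotated])
      (auto simp: takagi_phi_def intro!: always_eventually continuous_intros)
  then show ?thesis
    unfolding takagi_def[abs_def] using continuous_on_subset by blast
qed

section \<open>Self-similarity, symmetry and special values\<close>

lemma takagi_split: "takagi x = takagi_phi x + takagi (2 * x) / 2"
proof -
  have "takagi x = takagi_phi x + (\<Sum>n. takagi_phi (2 ^ Suc n * x) / 2 ^ Suc n)"
    unfolding takagi_def using suminf_split_head[OF summable_takagi[of x]] by simp
  also have "(\<Sum>n. takagi_phi (2 ^ Suc n * x) / 2 ^ Suc n)
      = (\<Sum>n. takagi_phi (2 ^ n * (2 * x)) / 2 ^ n / 2)"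
    by (simp add: mult.assoc mult.left_commute mult.commute[of _ 2])
  also have "\<dots> = takagi (2 * x) / 2"
    unfolding takagi_def by (rule suminf_divide[OF summable_takagi])
  finally show ?thesis .
qed

lemma takagi_add_nat: "takagi (x + real k) = takagi x"
proof -
  have "takagi_phi (2 ^ n * (x + real k)) = takagi_phi (2 ^ n * x)" for n
    using takagi_phi_add_int[of "2 ^ n * x" "2 ^ n * int k"] by (simp add: algebra_simps)
  then show ?thesis by (simp add: takagi_def)
qed

lemma takagi_minus: "takagi (- x) = takagi x"
  using takagi_phi_minus by (simp add: takagi_def)

lemma takagi_reflect: "takagi (1 - x) = takagi x"
  using takagi_add_nat[of "- x" 1] by (simp add: takagi_minus)

lemma takagi_0: "takagi 0 = 0"
  using takagi_split[of 0] takagi_phi_id[of 0] by simp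

text \<open>Doubling sends 1/3 to 2/3, its mirror image, so the functional equation becomes a linear
  equation for the value.\<close>

lemma takagi_third: "takagi (1 / 3) = 2 / 3"
  using takagi_split[of "1 / 3"] takagi_phi_id[of "1 / 3"] takagi_reflect[of "1 / 3"] by simp

lemma takagi_left_half: "x \<in> {0..1} \<Longrightarrow> takagi (x / 2) = x / 2 + takagi x / 2"
  using takagi_split[of "x / 2"] takagi_phi_id[of "x / 2"] by simp

lemma takagi_right_half: "x \<in> {0..1} \<Longrightarrow> takagi ((1 + x) / 2) = (1 - x) / 2 + takagi x / 2"
  using takagi_left_half[of "1 - x"] takagi_reflect[of "(1 + x) / 2"] takagi_reflect[of x]
  by (simp add: field_simps)

lemma takagi_half: "takagi (1 / 2) = 1 / 2"
  using takagi_left_half[of 1] takagi_reflect[of 0] by (simp add: takagi_0)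

lemma takagi_1: "takagi 1 = 0"
  using takagi_reflect[of 0] by (simp add: takagi_0)

lemma takagi_surj:
  assumes "y \<in> {0..2/3}"
  obtains x where "x \<in> {0..1}" "takagi x = y"
  using IVT'[of takagi 0 y "1 / 3"] assms continuous_on_takagi takagi_0 takagi_third by fastforce

subsection \<open>Dyadic cells\<close>

text \<open>Closed on both sides, so that images under \<open>takagi\<close> are compact; adjacent
  cells share an endpoint.\<close>

definition dyadic_cell :: "nat \<Rightarrow> nat \<Rightarrow> real set"
  where "dyadic_cell n k = {real k / 2 ^ n..(real k + 1) / 2 ^ n}"

text \<open>The slope of the \<open>n\<close>-th partial sum on the \<open>k\<close>-th cell, i.e. the number of zeros minus the
  number of ones among the first \<open>n\<close> binary digits of its points.\<close>

fun takagi_slope :: "nat \<Rightarrow> nat \<Rightarrow> int"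
  where
    "takagi_slope 0 k = 0"
  | "takagi_slope (Suc n) k = takagi_slope n (k div 2) + (if even k then 1 else - 1)"

text \<open>Induction on the last binary digit: cell \<open>k\<close> of order \<open>Suc n\<close>
  is a half of cell \<open>k div 2\<close> of order \<open>n\<close>, and the equation for the left
  or right half changes the slope by 1 or -1.\<close>

lemma takagi_scale:
  assumes "x \<in> {0..1}"
  shows "takagi ((real k + x) / 2 ^ n)
    = takagi (real k / 2 ^ n) + (of_int (takagi_slope n k) * x + takagi x) / 2 ^ n"
  using assms
proof (induction n arbitrary: k x)
  case 0
  show ?case using takagi_add_nat[of x k] takagi_add_nat[of 0 k] by (simp add: takagi_0 add.commute)
next
  case (Suc n)
  define j where "j = k div 2"
  show ?case
  proof (cases "even k")
    case True
    then have k: "k = 2 * j" by (simp add: j_def)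
    have "takagi ((real k + x) / 2 ^ Suc n) = takagi ((real j + x / 2) / 2 ^ n)"
      by (simp add: k field_simps)
    also have "\<dots> = takagi (real j / 2 ^ n) + (of_int (takagi_slope n j) * (x / 2) + takagi (x / 2)) / 2 ^ n"
      by (rule Suc.IH) (use Suc.prems in auto)
    also have "real j / 2 ^ n = real k / 2 ^ Suc n" by (simp add: k)
    finally show ?thesis
      using Suc.prems by (simp add: takagi_left_half k field_simps)
  next
    case False
    then have k: "k = 2 * j + 1" by (simp add: j_def)
    \<comment> \<open>The left end of an odd cell is the midpoint of its parent, so the parent's
      formula is needed at \<open>z = x\<close> and at \<open>z = 0\<close>.\<close>
    have *: "takagi ((real k + z) / 2 ^ Suc n)
        = takagi (real j / 2 ^ n) + (of_int (takagi_slope n j) * ((1 + z) / 2) + takagi ((1 + z) / 2)) / 2 ^ n"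
      if "z \<in> {0..1}" for z
    proof -
      have "(real k + z) / 2 ^ Suc n = (real j + (1 + z) / 2) / 2 ^ n"
        by (simp add: k field_simps)
      then show ?thesis using Suc.IH[of "(1 + z) / 2" j] that by simp
    qed
    show ?thesis
      using *[OF Suc.prems] *[of 0] takagi_right_half[OF Suc.prems] takagi_right_half[of 0]
      by (simp add: k takagi_0 field_simps)
  qed
qed

lemma dyadic_cell_param:
  assumes "a \<in> dyadic_cell n k"
  obtains x where "x \<in> {0..1}" "a = (real k + x) / 2 ^ n"
proof
  show "a * 2 ^ n - real k \<in> {0..1}" using assms by (auto simp: dyadic_cell_def field_simps)
qed simp

lemma dyadic_cell_paramI: "x \<in> {0..1} \<Longrightarrow> (real k + x) / 2 ^ n \<in> dyadic_cell n k"
  by (auto simp: dyadic_cell_def divide_right_mono)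

lemma dyadic_cell_Suc: "dyadic_cell n k = dyadic_cell (Suc n) (2 * k) \<union> dyadic_cell (Suc n) (2 * k + 1)"
proof -
  have "dyadic_cell (Suc n) (2 * k) = {real k / 2 ^ n..(2 * real k + 1) / 2 ^ Suc n}"
    "dyadic_cell (Suc n) (2 * k + 1) = {(2 * real k + 1) / 2 ^ Suc n..(real k + 1) / 2 ^ n}"
    by (auto simp: dyadic_cell_def field_simps)
  moreover have "real k / 2 ^ n \<le> (2 * real k + 1) / 2 ^ Suc n" "(2 * real k + 1) / 2 ^ Suc n \<le> (real k + 1) / 2 ^ n"
    by (auto simp: field_simps)
  ultimately show ?thesis unfolding dyadic_cell_def[of n k] by (simp only: ivl_disj_un_two_touch)
qed

lemma dyadic_cell_cover:
  assumes "x \<in> {0..1}"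
  shows "\<exists>k<2 ^ n. x \<in> dyadic_cell n k"
proof (induction n)
  case 0
  show ?case using assms by (simp add: dyadic_cell_def)
next
  case (Suc n)
  then obtain k where "k < 2 ^ n" "x \<in> dyadic_cell n k" by blast
  then have "2 * k < 2 ^ Suc n" "2 * k + 1 < 2 ^ Suc n" "x \<in> dyadic_cell (Suc n) (2 * k) \<union> dyadic_cell (Suc n) (2 * k + 1)"
    by (simp, simp, simp only: dyadic_cell_Suc[symmetric])
  then show ?case by blast
qed

lemma dyadic_cell_subset_unit:
  assumes "k < 2 ^ n"
  shows "dyadic_cell n k \<subseteq> {0..1}"
proof -
  have "real (k + 1) \<le> real (2 ^ n)" using assms by (intro of_nat_mono) simp
  then have "(real k + 1) / 2 ^ n \<le> 1" by (simp add: field_simps)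
  moreover have "0 \<le> real k / 2 ^ n" by simp
  ultimately show ?thesis unfolding dyadic_cell_def by (simp del: divide_le_eq_1_pos)
qed

text \<open>Passing to \<open>2 ^ n - 1 - k\<close> complements all \<open>n\<close> digits and so
  swaps zeros and ones. This reduces negative slopes to positive ones.\<close>

lemma takagi_slope_reflect:
  "k < 2 ^ n \<Longrightarrow> takagi_slope n (2 ^ n - 1 - k) = - takagi_slope n k"
proof (induction n arbitrary: k)
  case (Suc n)
  define j where "j = k div 2"
  have j: "j < 2 ^ n" using Suc.prems by (simp add: j_def)
  show ?case
  proof (cases "even k")
    case True
    then have k: "k = 2 * j" by (simp add: j_def)
    have "2 ^ Suc n - 1 - k = 2 * (2 ^ n - 1 - j) + 1" using j by (simp add: k)
    then show ?thesis using Suc.IH[OF j] by (simp add: k)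
  next
    case False
    then have k: "k = 2 * j + 1" by (simp add: j_def)
    have "2 ^ Suc n - 1 - k = 2 * (2 ^ n - 1 - j)" by (simp add: k)
    then show ?thesis using Suc.IH[OF j] by (simp add: k)
  qed
qed simp

lemma dyadic_cell_reflect:
  assumes "k < 2 ^ n" "a \<in> dyadic_cell n k"
  shows "1 - a \<in> dyadic_cell n (2 ^ n - 1 - k)"
proof -
  have "real (2 ^ n - 1 - k) = 2 ^ n - 1 - real k"
    using assms(1) by (simp add: of_nat_diff)
  then show ?thesis using assms(2) by (auto simp: dyadic_cell_def field_simps)
qed

subsection \<open>Infinite level sets and humps\<close>

text \<open>Slope 0 makes the affine part in \<open>takagi_scale\<close> constant, so these are the
  ordinates of all humps of order \<open>n\<close>; for odd \<open>n\<close> there are none.\<close>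

definition hump_levels :: "nat \<Rightarrow> real set"
  where "hump_levels n = (\<Union>k\<in>{k. k < 2 ^ n \<and> takagi_slope n k = 0}. takagi ` dyadic_cell n k)"

lemma hump_levelsI:
  "k < 2 ^ n \<Longrightarrow> takagi_slope n k = 0 \<Longrightarrow> a \<in> dyadic_cell n k \<Longrightarrow> takagi a \<in> hump_levels n"
  unfolding hump_levels_def by blast

text \<open>Follow \<open>a\<close> through \<open>p\<close> halvings. The slope stays positive and
  the value at the right end of the current cell never exceeds that at the original one; in the last
  cell, \<open>takagi x \<le> 1\<close> bounds the excess of \<open>takagi a\<close> over the right
  end value.\<close>

lemma takagi_le_right_end_approx:
  assumes free: "\<And>n. N \<le> n \<Longrightarrow> takagi a \<notin> hump_levels n"
    and "N \<le> n" "k < 2 ^ n" "0 < takagi_slope n k" "a \<in> dyadic_cell n k"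
  shows "takagi a \<le> takagi ((real k + 1) / 2 ^ n) + (1 / 2) ^ (n + p)"
  using assms(2-)
proof (induction p arbitrary: n k)
  case 0
  obtain x where x: "x \<in> {0..1}" "a = (real k + x) / 2 ^ n"
    using \<open>a \<in> dyadic_cell n k\<close> by (rule dyadic_cell_param)
  have "of_int (takagi_slope n k) * x \<le> of_int (takagi_slope n k)"
    using x 0 by (simp add: mult_le_cancel_left1)
  then have "of_int (takagi_slope n k) * x + takagi x \<le> of_int (takagi_slope n k) + 1"
    using takagi_le_1[of x] by simp
  then have "(of_int (takagi_slope n k) * x + takagi x) / 2 ^ n \<le> (of_int (takagi_slope n k) + 1) / 2 ^ n"
    by (rule divide_right_mono) simp
  then show ?case
    using takagi_scale[OF x(1), of k n] takagi_scale[of 1 k n] x(2)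
    by (simp add: takagi_1 add_divide_distrib power_one_over)
next
  case (Suc p)
  from Suc.prems(4) consider "a \<in> dyadic_cell (Suc n) (2 * k)" | "a \<in> dyadic_cell (Suc n) (2 * k + 1)"
    unfolding dyadic_cell_Suc[of n k] by blast
  then show ?case
  proof cases
    case 1
    \<comment> \<open>With slope \<open>s\<close>, the midpoint value exceeds the left end value by
      \<open>(s / 2 + 1 / 2) / 2 ^ n\<close> and the right end value exceeds it by
      \<open>s / 2 ^ n\<close>; \<open>s \<ge> 1\<close> orders them.\<close>
    have "(1::real) \<le> of_int (takagi_slope n k)" using Suc.prems(3) by simp
    then have "(of_int (takagi_slope n k) / 2 + 1 / 2) / 2 ^ n \<le> of_int (takagi_slope n k) / (2 ^ n :: real)"
      by (intro divide_right_mono) auto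
    then have "takagi ((real k + 1 / 2) / 2 ^ n) \<le> takagi ((real k + 1) / 2 ^ n)"
      using takagi_scale[of "1 / 2" k n] takagi_scale[of 1 k n] by (simp add: takagi_1 takagi_half)
    moreover have "(real k + 1 / 2) / 2 ^ n = (real (2 * k) + 1) / 2 ^ Suc n" by (simp add: field_simps)
    ultimately show ?thesis using Suc.IH[of "Suc n" "2 * k"] Suc.prems 1 by simp
  next
    case 2
    \<comment> \<open>Otherwise the right half would carry a hump through \<open>a\<close>, against
      \<open>free\<close>.\<close>
    have "takagi_slope (Suc n) (2 * k + 1) \<noteq> 0"
      using hump_levelsI[OF _ _ 2] free[of "Suc n"] Suc.prems by fastforce
    then have "0 < takagi_slope (Suc n) (2 * k + 1)" using Suc.prems by simp
    moreover have "(real (2 * k + 1) + 1) / 2 ^ Suc n = (real k + 1) / 2 ^ n" by (simp add: field_simps)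
    ultimately show ?thesis using Suc.IH[of "Suc n" "2 * k + 1"] Suc.prems 2 by simp
  qed
qed

lemma takagi_le_right_end:
  assumes "\<And>n. N \<le> n \<Longrightarrow> takagi a \<notin> hump_levels n"
    and "N \<le> n" "k < 2 ^ n" "0 < takagi_slope n k" "a \<in> dyadic_cell n k"
  shows "takagi a \<le> takagi ((real k + 1) / 2 ^ n)"
proof (rule field_le_epsilon)
  fix e :: real assume "0 < e"
  then obtain p where p: "(1 / 2) ^ p < e" using real_arch_pow_inv[of e "1 / 2"] by auto
  have "(1 / 2 :: real) ^ (n + p) \<le> (1 / 2) ^ p" by (rule power_decreasing) auto
  then show "takagi a \<le> takagi ((real k + 1) / 2 ^ n) + e"
    using takagi_le_right_end_approx[OF assms, of p] p by linarith
qed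

text \<open>Outside the humps the slopes of the cells shrinking to a point never change sign, so that the
  function is strictly monotone along each cell.\<close>

lemma takagi_less_if_hump_free:
  assumes free: "\<And>n. N \<le> n \<Longrightarrow> takagi a \<notin> hump_levels n" "\<And>n. N \<le> n \<Longrightarrow> takagi b \<notin> hump_levels n"
    and "N \<le> n" "k < 2 ^ n" "0 < takagi_slope n k" "a \<in> dyadic_cell n k" "b \<in> dyadic_cell n k" "a < b"
  shows "takagi a < takagi b"
proof -
  \<comment> \<open>Cells of order \<open>n + p\<close> are too short to contain both points, so the
    descent separates them within \<open>p\<close> halvings and the base case is
    contradictory.\<close>
  obtain p where p: "(1 / 2) ^ p < b - a" using real_arch_pow_inv[of "b - a" "1 / 2"] \<open>a < b\<close> by auto
  have "(1 / 2 :: real) ^ (n + p) \<le> (1 / 2) ^ p" by (rule power_decreasing) auto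
  with p have "(1 / 2) ^ (n + p) < b - a" by linarith
  then show ?thesis using assms(3-7)
  proof (induction p arbitrary: n k)
    case 0
    then have "b - a \<le> (real k + 1) / 2 ^ n - real k / 2 ^ n" by (auto simp: dyadic_cell_def)
    then show ?case using 0 by (simp add: add_divide_distrib power_one_over)
  next
    case (Suc p)
    \<comment> \<open>If the midpoint does not separate the points, descend into the half containing
      both; otherwise compare both values with that at \<open>c\<close>.\<close>
    define c where "c = (real k + 1 / 2) / 2 ^ n"
    have c: "c = (real (2 * k) + 1) / 2 ^ Suc n" "c = real (2 * k + 1) / 2 ^ Suc n"
      by (simp_all add: c_def field_simps)
    have right: "0 < takagi_slope (Suc n) (2 * k + 1)"
      if "x \<in> dyadic_cell (Suc n) (2 * k + 1)" "takagi x \<notin> hump_levels (Suc n)" for x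
    proof -
      have "takagi_slope (Suc n) (2 * k + 1) \<noteq> 0"
        using hump_levelsI[OF _ _ that(1)] that(2) Suc.prems by fastforce
      then show ?thesis using Suc.prems by simp
    qed
    show ?case
    proof (cases "b \<le> c")
      case True
      then have "a \<in> dyadic_cell (Suc n) (2 * k)" "b \<in> dyadic_cell (Suc n) (2 * k)"
        using Suc.prems \<open>a < b\<close> by (auto simp: dyadic_cell_def c(1))
      then show ?thesis using Suc.IH[of "Suc n" "2 * k"] Suc.prems by simp
    next
      case False
      then have b: "b \<in> dyadic_cell (Suc n) (2 * k + 1)"
        using Suc.prems unfolding dyadic_cell_Suc[of n k]
        by (auto simp: c(1) dyadic_cell_def[of "Suc n" "2 * k"])
      have s: "0 < takagi_slope (Suc n) (2 * k + 1)"
        using right[OF b] free(2)[of "Suc n"] Suc.prems by simp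
      show ?thesis
      proof (cases "c \<le> a")
        case True
        then have "a \<in> dyadic_cell (Suc n) (2 * k + 1)"
          using b \<open>a < b\<close> by (auto simp: dyadic_cell_def c(2))
        then show ?thesis using Suc.IH[of "Suc n" "2 * k + 1"] Suc.prems b s by simp
      next
        case c_le: False
        then have "a \<in> dyadic_cell (Suc n) (2 * k)"
          using Suc.prems by (auto simp: dyadic_cell_def c(1))
        then have "takagi a \<le> takagi c"
          unfolding c(1) by (rule takagi_le_right_end[OF free(1) le_SucI, rotated -1]) (use Suc.prems in simp_all)
        \<comment> \<open>As \<open>c\<close> is the left end of a cell of positive slope, any later
          point of that cell has a strictly larger value.\<close>
        also obtain x where x: "x \<in> {0..1}" "b = (real (2 * k + 1) + x) / 2 ^ Suc n"
          using b by (rule dyadic_cell_param)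
        have "x \<noteq> 0" using False x(2) c(2) by auto
        then have "0 < of_int (takagi_slope (Suc n) (2 * k + 1)) * x + takagi x"
          using s x takagi_nonneg[of x] by (intro add_pos_nonneg mult_pos_pos) auto
        then have "takagi c < takagi b"
          unfolding x(2) c(2) takagi_scale[OF x(1)] by simp
        finally show ?thesis .
      qed
    qed
  qed
qed

text \<open>If \<open>y\<close> avoided all humps from order \<open>N\<close> on, one of the
  \<open>2 ^ N\<close> cells would contain two points of the level set, against strict monotonicity
  on that cell.\<close>

lemma infinite_level_imp_hump:
  assumes "infinite (takagi_level y)"
  shows "\<exists>n\<ge>N. y \<in> hump_levels n"
proof (rule ccontr)
  assume "\<not> ?thesis"
  then have free: "y \<notin> hump_levels n" if "N \<le> n" for n using that by blast
  have "\<exists>k<2 ^ N. infinite (takagi_level y \<inter> dyadic_cell N k)"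
  proof (rule ccontr)
    assume "\<not> ?thesis"
    then have "finite (\<Union>k\<in>{..<2 ^ N}. takagi_level y \<inter> dyadic_cell N k)"
      by (intro finite_UN_I) auto
    moreover have "takagi_level y \<subseteq> (\<Union>k\<in>{..<2 ^ N}. takagi_level y \<inter> dyadic_cell N k)"
      using dyadic_cell_cover[of _ N] by (fastforce simp: takagi_level_def)
    ultimately show False using assms finite_subset by blast
  qed
  then obtain k where k: "k < 2 ^ N" "infinite (takagi_level y \<inter> dyadic_cell N k)" by blast
  have "\<exists>a b. a \<in> takagi_level y \<inter> dyadic_cell N k \<and> b \<in> takagi_level y \<inter> dyadic_cell N k \<and> a < b"
  proof (rule ccontr)
    assume "\<not> ?thesis"
    then have "a = b" if "a \<in> takagi_level y \<inter> dyadic_cell N k" "b \<in> takagi_level y \<inter> dyadic_cell N k" for a b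
      using that by (metis linorder_neqE_linordered_idom)
    then have "is_singleton (takagi_level y \<inter> dyadic_cell N k) \<or> takagi_level y \<inter> dyadic_cell N k = {}"
      by (metis is_singletonI')
    then show False using k(2) by (metis finite.emptyI finite.insertI is_singleton_def)
  qed
  then obtain a b where ab: "takagi a = y" "takagi b = y" "a \<in> dyadic_cell N k" "b \<in> dyadic_cell N k" "a < b"
    by (auto simp: takagi_level_def)
  have "takagi_slope N k \<noteq> 0" using hump_levelsI[OF k(1) _ ab(3)] free[of N] ab(1) by auto
  \<comment> \<open>A cell of negative slope is mirrored to one of positive slope, which reverses
    the order of \<open>a\<close> and \<open>b\<close>.\<close>
  then consider "0 < takagi_slope N k" | "0 < takagi_slope N (2 ^ N - 1 - k)"
    using takagi_slope_reflect[OF k(1)] by linarith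
  then show False
  proof cases
    case 1
    then have "takagi a < takagi b"
      by (intro takagi_less_if_hump_free[of N a b N k]) (use free ab k(1) in auto)
    then show ?thesis using ab by simp
  next
    case 2
    then have "takagi (1 - b) < takagi (1 - a)"
      by (intro takagi_less_if_hump_free[of N "1 - b" "1 - a" N "2 ^ N - 1 - k"] dyadic_cell_reflect)
        (use free ab k(1) in \<open>auto simp: takagi_reflect\<close>)
    then show ?thesis using ab by (simp add: takagi_reflect)
  qed
qed

text \<open>Reflecting a point of the level set in the humps through it yields further points of the
  level set arbitrarily close to it: the point is the centre of at most one of its cells.\<close>

lemma hump_imp_infinite_level:
  assumes "infinite {n. y \<in> hump_levels n}"
  shows "infinite (takagi_level y)"
proof
  assume fin: "finite (takagi_level y)"
  define H where "H x = {n. \<exists>k. k < 2 ^ n \<and> takagi_slope n k = 0 \<and> x \<in> dyadic_cell n k}" for x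
  have "{n. y \<in> hump_levels n} \<subseteq> (\<Union>x\<in>takagi_level y. H x)"
    using dyadic_cell_subset_unit by (fastforce simp: hump_levels_def takagi_level_def H_def)
  then have "infinite (\<Union>x\<in>takagi_level y. H x)" using assms finite_subset by blast
  \<comment> \<open>Pigeonhole: one of finitely many points lies in humps of infinitely many
    orders.\<close>
  then obtain x where x: "x \<in> takagi_level y" "infinite (H x)" using fin by blast
  obtain d where d: "d > 0" "\<And>z. z \<in> takagi_level y \<Longrightarrow> z \<noteq> x \<Longrightarrow> d \<le> dist x z"
    using finite_set_avoid[OF fin, of x] by blast
  obtain M where M: "(1 / 2 :: real) ^ M < d" using real_arch_pow_inv[of d "1 / 2"] d(1) by auto
  \<comment> \<open>The mirror image \<open>z\<close> of \<open>x\<close> in its hump is in the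
    level set and closer to \<open>x\<close> than \<open>d\<close>; hence \<open>z = x\<close>, the
    centre of the hump.\<close>
  have center: "\<exists>k. x * 2 ^ Suc n = of_int (2 * k + 1)" if n: "n \<in> H x" "M \<le> n" for n
  proof -
    obtain k where k: "k < 2 ^ n" "takagi_slope n k = 0" "x \<in> dyadic_cell n k"
      using n by (auto simp: H_def)
    obtain t where t: "t \<in> {0..1}" "x = (real k + t) / 2 ^ n" using k(3) by (rule dyadic_cell_param)
    define z where "z = (real k + (1 - t)) / 2 ^ n"
    have t': "1 - t \<in> {0..1}" using t by auto
    have "takagi z = takagi x"
      using takagi_scale[OF t', of k n] takagi_scale[OF t(1), of k n] k(2)
      by (simp add: z_def t(2) takagi_reflect)
    moreover have "z \<in> {0..1}"
      using dyadic_cell_paramI[OF t', of k n] dyadic_cell_subset_unit[OF k(1)] by (auto simp: z_def)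
    ultimately have z: "z \<in> takagi_level y" using x(1) by (simp add: takagi_level_def)
    have "dist x z = \<bar>2 * t - 1\<bar> / 2 ^ n"
      by (simp add: dist_real_def t(2) z_def diff_divide_distrib[symmetric] abs_divide)
    also have "\<dots> \<le> 1 / 2 ^ n" using t(1) by (intro divide_right_mono) auto
    also have "\<dots> \<le> (1 / 2) ^ M"
      unfolding power_one_over[symmetric] using n(2) by (intro power_decreasing) auto
    finally have "z = x" using d(2)[OF z] M by fastforce
    then have "t = 1 / 2" by (simp add: z_def t(2) field_simps)
    then have "x * 2 ^ Suc n = of_int (2 * int k + 1)" by (simp add: t(2) field_simps)
    then show ?thesis by blast
  qed
  obtain n where n: "n \<in> H x" "M < n" using x(2) by (auto simp: infinite_nat_iff_unbounded)
  obtain m where m: "m \<in> H x" "n < m" using x(2) by (auto simp: infinite_nat_iff_unbounded)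
  obtain i j where ij: "x * 2 ^ Suc n = of_int (2 * i + 1)" "x * 2 ^ Suc m = of_int (2 * j + 1)"
    using center n m by (meson less_imp_le less_trans)
  obtain q where q: "m = n + Suc q" using m(2) less_iff_Suc_add by auto
  \<comment> \<open>Centres of cells of orders \<open>n < m\<close> cannot coincide: an odd number
    would be an even multiple of another.\<close>
  have "real_of_int (2 * j + 1) = of_int ((2 * i + 1) * (2 * 2 ^ q))"
    unfolding of_int_mult ij[symmetric] by (simp add: q power_add)
  then have "2 * j + 1 = (2 * i + 1) * (2 * 2 ^ q)" by (simp only: of_int_eq_iff)
  then have "even (2 * j + 1)" by simp
  then show False by simp
qed

lemma infinite_level_iff: "infinite (takagi_level y) \<longleftrightarrow> (\<forall>N. \<exists>n\<ge>N. y \<in> hump_levels n)"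
  using infinite_level_imp_hump hump_imp_infinite_level[of y]
  by (auto simp: infinite_nat_iff_unbounded_le)

subsection \<open>Small level sets are nowhere dense\<close>

text \<open>The middle quarters have digits 01 and 10, so both have slope 0 and carry humps at the
  same height 1/2.\<close>

lemma takagi_quarters:
  assumes "x \<in> {0..1}"
  shows "takagi ((1 + x) / 4) = 1 / 2 + takagi x / 4" "takagi ((2 + x) / 4) = 1 / 2 + takagi x / 4"
  using assms takagi_left_half[of "(1 + x) / 2"] takagi_right_half[of x]
    takagi_right_half[of "x / 2"] takagi_left_half[of x]
  by (simp_all add: field_simps)

text \<open>Each step copies the preimages into both middle quarters, doubling their number. The
  copies could meet only at 1/2, which comes from 0 in the right one; hence the condition
  \<open>0 \<notin> F\<close>.\<close>

lemma takagi_many_preimages: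
  "\<exists>p q. p < q \<and> (\<forall>y\<in>{p<..<q}. \<exists>F\<subseteq>{0..1}. card F = 2 ^ j \<and> 0 \<notin> F \<and> takagi ` F \<subseteq> {y})"
proof (induction j)
  case 0
  have "\<exists>F\<subseteq>{0..1}. card F = 2 ^ 0 \<and> 0 \<notin> F \<and> takagi ` F \<subseteq> {y}"
    if y: "y \<in> {0<..<2/3}" for y
  proof -
    obtain x where "x \<in> {0..1}" "takagi x = y" using takagi_surj[of y] y by auto
    then show ?thesis using y by (intro exI[of _ "{x}"]) (auto simp: takagi_0 takagi_1)
  qed
  then show ?case by (intro exI[of _ 0] exI[of _ "2 / 3"]) auto
next
  case (Suc j)
  then obtain p q where pq: "p < q"
    and F: "\<And>y. y \<in> {p<..<q} \<Longrightarrow> \<exists>F\<subseteq>{0..1}. card F = 2 ^ j \<and> 0 \<notin> F \<and> takagi ` F \<subseteq> {y}"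
    by blast
  have "\<exists>F\<subseteq>{0..1}. card F = 2 ^ Suc j \<and> 0 \<notin> F \<and> takagi ` F \<subseteq> {y}"
    if y: "y \<in> {1 / 2 + p / 4<..<1 / 2 + q / 4}" for y
  proof -
    obtain F where F: "F \<subseteq> {0..1}" "card F = 2 ^ j" "0 \<notin> F" "takagi ` F \<subseteq> {4 * y - 2}"
      using F[of "4 * y - 2"] y by auto
    have val: "takagi x = 4 * y - 2" if "x \<in> F" for x using F(4) that by blast
    let ?A = "(\<lambda>x. (1 + x) / 4) ` F" and ?B = "(\<lambda>x. (2 + x) / 4) ` F"
    \<comment> \<open>Infinite sets have \<open>card\<close> 0, which is not a power of 2.\<close>
    have "finite F" using F(2) by (metis card.infinite power_not_zero zero_neq_numeral)
    moreover have "?A \<inter> ?B = {}"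
    proof (rule ccontr)
      assume "\<not> ?thesis"
      then obtain u v where uv: "u \<in> F" "v \<in> F" "(1 + u) / 4 = (2 + v) / 4" by blast
      moreover have "u \<in> {0..1}" "v \<in> {0..1}" using uv(1,2) F(1) by blast+
      ultimately have "v = 0" by simp
      then show False using uv F(3) by simp
    qed
    moreover have "card ?A = card F" "card ?B = card F" by (auto intro!: card_image inj_onI)
    ultimately have "card (?A \<union> ?B) = 2 ^ Suc j" using F(2) by (simp add: card_Un_disjoint)
    moreover have "?A \<union> ?B \<subseteq> {0..1}" "0 \<notin> ?A \<union> ?B" using F(1) by force+
    moreover have "takagi ` (?A \<union> ?B) \<subseteq> {y}"
      using takagi_quarters[OF subsetD[OF F(1)]] val by (auto simp: diff_divide_distrib)
    ultimately show ?thesis by blast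
  qed
  moreover have "1 / 2 + p / 4 < 1 / 2 + q / 4" using pq by simp
  ultimately show ?case by blast
qed

text \<open>Choosing the right half when the slope is positive and the left half when it is negative
  brings the slope one step closer to 0.\<close>

lemma hump_in_dyadic_cell:
  assumes "k < 2 ^ n"
  obtains m j where "j < 2 ^ m" "takagi_slope m j = 0" "dyadic_cell m j \<subseteq> dyadic_cell n k"
proof -
  have "\<exists>m j. j < 2 ^ m \<and> takagi_slope m j = 0 \<and> dyadic_cell m j \<subseteq> dyadic_cell n k"
    using assms
  proof (induction "nat \<bar>takagi_slope n k\<bar>" arbitrary: n k)
    case 0
    then show ?case by (intro exI[of _ n] exI[of _ k]) auto
  next
    case (Suc s)
    show ?case
    proof (cases "0 < takagi_slope n k")
      case True
      have "\<exists>m j. j < 2 ^ m \<and> takagi_slope m j = 0 \<and> dyadic_cell m j \<subseteq> dyadic_cell (Suc n) (2 * k + 1)"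
        by (rule Suc.hyps(1)) (use True Suc in auto)
      then show ?thesis unfolding dyadic_cell_Suc[of n k] by blast
    next
      case False
      have "\<exists>m j. j < 2 ^ m \<and> takagi_slope m j = 0 \<and> dyadic_cell m j \<subseteq> dyadic_cell (Suc n) (2 * k)"
        by (rule Suc.hyps(1)) (use False Suc in auto)
      then show ?thesis unfolding dyadic_cell_Suc[of n k] by blast
    qed
  qed
  then show ?thesis using that by blast
qed

text \<open>By continuity some small cell is mapped into \<open>{c<..<d}\<close>. It contains a
  hump, and there the interval from \<open>takagi_many_preimages\<close> reappears, shifted and
  scaled, with \<open>2 ^ m > m\<close> preimages.\<close>

lemma takagi_many_preimages_dense:
  assumes "0 \<le> c" "c < d" "d \<le> 2 / 3"
  obtains c' d' where "c' < d'" "{c'<..<d'} \<subseteq> {c<..<d}" "{c'<..<d'} \<inter> takagi_S_le m = {}"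
proof -
  obtain x where x: "x \<in> {0..1}" "takagi x = (c + d) / 2"
    using takagi_surj[of "(c + d) / 2"] assms by auto
  have "open (takagi -` {c<..<d})" using continuous_on_takagi by (intro open_vimage) auto
  moreover have "x \<in> takagi -` {c<..<d}" using x assms by simp
  ultimately obtain e where e: "e > 0" "ball x e \<subseteq> takagi -` {c<..<d}" by (meson open_contains_ball)
  obtain n where n: "(1 / 2) ^ n < e" using real_arch_pow_inv[of e "1 / 2"] e by auto
  obtain k where k: "k < 2 ^ n" "x \<in> dyadic_cell n k" using dyadic_cell_cover[OF x(1)] by blast
  have "dyadic_cell n k \<subseteq> ball x e"
  proof
    fix z assume "z \<in> dyadic_cell n k"
    then have "dist x z \<le> (real k + 1) / 2 ^ n - real k / 2 ^ n"
      using k(2) unfolding dist_real_def by (auto simp: dyadic_cell_def)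
    then show "z \<in> ball x e" using n by (simp add: add_divide_distrib power_one_over)
  qed
  moreover obtain l j where lj: "j < 2 ^ l" "takagi_slope l j = 0" "dyadic_cell l j \<subseteq> dyadic_cell n k"
    using hump_in_dyadic_cell[OF k(1)] .
  ultimately have cd: "takagi z \<in> {c<..<d}" if "z \<in> dyadic_cell l j" for z using that e by blast
  obtain p q where pq: "p < q"
    and F: "\<And>y. y \<in> {p<..<q} \<Longrightarrow> \<exists>F\<subseteq>{0..1}. card F = 2 ^ m \<and> 0 \<notin> F \<and> takagi ` F \<subseteq> {y}"
    using takagi_many_preimages[of m] by blast
  let ?t = "takagi (real j / 2 ^ l)"
  have main: "y \<in> {c<..<d} \<and> y \<notin> takagi_S_le m" if y: "y \<in> {?t + p / 2 ^ l<..<?t + q / 2 ^ l}" for y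
  proof -
    have "(y - ?t) * 2 ^ l \<in> {p<..<q}" using y by (auto simp: field_simps)
    then obtain F where F: "F \<subseteq> {0..1}" "card F = 2 ^ m" "takagi ` F \<subseteq> {(y - ?t) * 2 ^ l}"
      using F by blast
    let ?G = "(\<lambda>x. (real j + x) / 2 ^ l) ` F"
    have G: "card ?G = 2 ^ m" using F(2) by (subst card_image) (auto intro!: inj_onI)
    have val: "takagi z = y" if "z \<in> ?G" for z
      using that F(1,3) lj(2) by (auto simp: takagi_scale subset_iff)
    have cell: "?G \<subseteq> dyadic_cell l j" using F(1) dyadic_cell_paramI by blast
    have sub: "?G \<subseteq> takagi_level y"
      using val cell dyadic_cell_subset_unit[OF lj(1)] unfolding takagi_level_def by blast
    \<comment> \<open>The bounds on \<open>y\<close> come from a preimage: it lies in a cell mapped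
      into \<open>{c<..<d}\<close>.\<close>
    have "?G \<noteq> {}" using G by (metis card.empty power_not_zero zero_neq_numeral)
    then have "y \<in> {c<..<d}" using val cell cd by blast
    moreover have "m < card (takagi_level y)" if "finite (takagi_level y)"
      using card_mono[OF that sub] G less_exp[of m] by linarith
    ultimately show ?thesis by (auto simp: takagi_S_le_def)
  qed
  show ?thesis
  proof (rule that)
    show "?t + p / 2 ^ l < ?t + q / 2 ^ l" using pq by (simp add: divide_strict_right_mono)
  qed (use main in blast)+
qed

lemma takagi_S_le_nowhere_dense: "nowhere_dense_in (top_of_set {0..2/3}) (takagi_S_le m)"
proof -
  let ?X = "top_of_set {0..2/3 :: real}"
  have False if y: "y \<in> ?X interior_of (?X closure_of takagi_S_le m)" for y
  proof -
    obtain U where U: "openin ?X U" "y \<in> U" "U \<subseteq> ?X closure_of takagi_S_le m"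
      using y unfolding interior_of_def by blast
    then obtain e where e: "e > 0" "ball y e \<inter> {0..2/3} \<subseteq> U"
      unfolding openin_contains_ball by blast
    have y01: "y \<in> {0..2/3}" using openin_subset[OF U(1)] U(2) by auto
    \<comment> \<open>Clipping is needed because \<open>y\<close> may be an endpoint of
      \<open>{0..2/3}\<close>.\<close>
    define c where "c = max 0 (y - e / 2)"
    define d where "d = min (2 / 3) (y + e / 2)"
    have "0 \<le> y" "y \<le> 2 / 3" using y01 by simp_all
    then have cd: "0 \<le> c" "c < d" "d \<le> 2 / 3"
      using e(1) by (simp_all add: c_def d_def max_def min_def)
    have sub: "{c<..<d} \<subseteq> ball y e \<inter> {0..2/3}"
      using e(1) by (auto simp: c_def d_def dist_real_def)
    obtain c' d' where c'd': "c' < d'" "{c'<..<d'} \<subseteq> {c<..<d}" "{c'<..<d'} \<inter> takagi_S_le m = {}"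
      using takagi_many_preimages_dense[OF cd] .
    have mid: "(c' + d') / 2 \<in> {c'<..<d'}" using c'd'(1) by simp
    then have "(c' + d') / 2 \<in> ?X closure_of takagi_S_le m" using c'd'(2) sub e(2) U(3) by blast
    moreover have "openin ?X {c'<..<d'}"
      using c'd'(2) sub by (intro open_subset) auto
    ultimately show False using mid c'd'(3) unfolding in_closure_of by blast
  qed
  moreover have "takagi_S_le m \<subseteq> topspace ?X" by (auto simp: takagi_S_le_def)
  ultimately show ?thesis unfolding nowhere_dense_in_def by blast
qed

lemma takagi_S_inf_residual: "residual_in (top_of_set {0..2/3}) takagi_S_inf"
proof -
  have "{0..2/3} - takagi_S_inf = \<Union>(range takagi_S_le)"
    by (auto simp: takagi_S_inf_def takagi_S_le_def)
  then have "first_category_in (top_of_set {0..2/3}) ({0..2/3} - takagi_S_inf)"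
    unfolding first_category_in_def using takagi_S_le_nowhere_dense
    by (intro exI[of _ "range takagi_S_le"]) blast
  moreover have "takagi_S_inf \<subseteq> {0..2/3}" by (auto simp: takagi_S_inf_def)
  ultimately show ?thesis by (simp add: residual_in_def)
qed

subsection \<open>Borel complexity\<close>

lemma borel_Pi0_closed:
  assumes "closedin X C"
  shows "borel_Pi0 X 1 C"
proof -
  have "borel_Pi0 X 1 (topspace X - (topspace X - C))"
    using assms by (intro compl "open") (simp add: openin_diff)
  then show ?thesis using closedin_subset[OF assms] by (simp add: double_diff)
qed

lemma borel_Pi0_2_Inter_open:
  assumes "\<And>n::nat. openin X (W n)"
  shows "borel_Pi0 X 2 (\<Inter>n. W n)"
proof -
  have "borel_Sigma0 X 2 (\<Union>n. topspace X - W n)"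
    using assms by (intro union[where m = "\<lambda>_. 1"] conjI borel_Pi0_closed closedin_diff) auto
  then have "borel_Pi0 X 2 (topspace X - (\<Union>n. topspace X - W n))" by (rule compl)
  also have "topspace X - (\<Union>n. topspace X - W n) = (\<Inter>n. W n)"
    using openin_subset[OF assms] by fastforce
  finally show ?thesis .
qed

text \<open>Each hump has a compact interval as range, and the frontier of a finite union lies in
  the union of the frontiers.\<close>

lemma hump_levels_finite_frontier: "finite (frontier (hump_levels n))"
  and compact_hump_levels: "compact (hump_levels n)"
proof -
  have c: "compact (takagi ` dyadic_cell n k)" for k
    by (intro compact_continuous_image continuous_on_takagi) (simp add: dyadic_cell_def)
  then show "compact (hump_levels n)" unfolding hump_levels_def by (intro compact_UN) auto
  have f: "finite (frontier (takagi ` dyadic_cell n k))" for k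
  proof -
    have "connected (takagi ` dyadic_cell n k)"
      by (intro connected_continuous_image continuous_on_takagi) (simp add: dyadic_cell_def)
    with c obtain a b where ab: "takagi ` dyadic_cell n k = {a..b}"
      using connected_compact_interval_1 by blast
    have "frontier {a..b} \<subseteq> {a, b}" by (auto simp: frontier_def)
    then show ?thesis unfolding ab using finite_subset by blast
  qed
  have "frontier (hump_levels n)
      \<subseteq> (\<Union>k\<in>{k. k < 2 ^ n \<and> takagi_slope n k = 0}. frontier (takagi ` dyadic_cell n k))"
    unfolding hump_levels_def by (rule order.trans[OF frontier_Union_subset]) auto
  moreover have "finite \<dots>" using f by (intro finite_UN_I) auto
  ultimately show "finite (frontier (hump_levels n))" by (rule finite_subset)
qed

lemma takagi_S_inf_eq: "takagi_S_inf = (\<Inter>N. \<Union>n\<in>{N..}. {0..2/3} \<inter> hump_levels n)"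
  by (auto simp: takagi_S_inf_def infinite_level_iff)

lemma takagi_S_inf_Pi0: "borel_Pi0 (top_of_set {0..2/3}) 3 takagi_S_inf"
proof -
  let ?X = "top_of_set {0..2/3 :: real}"
  have "openin ?X ({0..2/3} - hump_levels n)" for n
    unfolding Diff_eq by (intro openin_open_Int open_Compl compact_imp_closed compact_hump_levels)
  \<comment> \<open>The shift \<open>N + n\<close> turns the tail from \<open>N\<close> on into an
    intersection over all naturals.\<close>
  then have "borel_Pi0 ?X 2 (\<Inter>n. {0..2/3} - hump_levels (N + n))" for N
    by (intro borel_Pi0_2_Inter_open)
  then have "borel_Sigma0 ?X 3 (\<Union>N. \<Inter>n. {0..2/3} - hump_levels (N + n))"
    by (intro union[where m = "\<lambda>_. 2"]) auto
  then have "borel_Pi0 ?X 3 (topspace ?X - (\<Union>N. \<Inter>n. {0..2/3} - hump_levels (N + n)))"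
    by (rule compl)
  also have "topspace ?X - (\<Union>N. \<Inter>n. {0..2/3} - hump_levels (N + n)) = takagi_S_inf"
    by (auto simp: takagi_S_inf_def infinite_level_iff le_iff_add)
  finally show ?thesis .
qed

lemma takagi_S_inf_Sigma0: "borel_Sigma0 (top_of_set {0..2/3}) 3 takagi_S_inf"
proof -
  let ?X = "top_of_set {0..2/3 :: real}"
  define G where "G = (\<Inter>N. \<Union>n\<in>{N..}. {0..2/3} \<inter> interior (hump_levels n))"
  have G: "borel_Pi0 ?X 2 G"
    unfolding G_def by (intro borel_Pi0_2_Inter_open openin_Union) (auto simp: openin_open_Int)
  have G_sub: "G \<subseteq> takagi_S_inf"
    unfolding G_def takagi_S_inf_eq by (intro INF_mono' UN_mono Int_mono order.refl interior_subset)
  \<comment> \<open>A point lost with the interiors is outside all of them from some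
    \<open>N\<close> on, yet in a later \<open>hump_levels n\<close>, hence on its frontier.\<close>
  have "takagi_S_inf - G \<subseteq> (\<Union>n. frontier (hump_levels n))"
  proof
    fix y assume y: "y \<in> takagi_S_inf - G"
    then obtain N where N: "\<forall>n\<ge>N. y \<notin> interior (hump_levels n)"
      by (auto simp: G_def takagi_S_inf_def)
    moreover obtain n where "n \<ge> N" "y \<in> hump_levels n" using y by (auto simp: takagi_S_inf_eq)
    ultimately show "y \<in> (\<Union>n. frontier (hump_levels n))"
      using closure_subset[of "hump_levels n"] unfolding frontier_def by blast
  qed
  moreover have "countable (\<Union>n. frontier (hump_levels n))"
    using hump_levels_finite_frontier by (intro countable_UN) (auto intro: countable_finite)
  ultimately have D: "countable (takagi_S_inf - G)" by (rule countable_subset)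
  \<comment> \<open>Index 0 holds the G-delta part; the other indices enumerate the countable
    remainder by sets of at most one point, which are closed.\<close>
  define A where "A k = (case k of 0 \<Rightarrow> G
    | Suc i \<Rightarrow> {y \<in> takagi_S_inf - G. to_nat_on (takagi_S_inf - G) y = i})" for k
  have "borel_Sigma0 ?X 3 (\<Union>k. A k)"
  proof (rule union[where m = "\<lambda>k. if k = 0 then 2 else 1"])
    fix k
    show "(if k = 0 then 2 else 1) < (3 :: nat) \<and> borel_Pi0 ?X (if k = 0 then 2 else 1) (A k)"
    proof (cases k)
      case 0
      then show ?thesis using G by (simp add: A_def)
    next
      case (Suc i)
      have "A k \<subseteq> {from_nat_into (takagi_S_inf - G) i}" using D by (auto simp: A_def Suc)
      then have "finite (A k)" using finite_subset by blast
      moreover have "A k \<subseteq> {0..2/3}" by (auto simp: A_def Suc takagi_S_inf_def)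
      ultimately have "closedin ?X (A k)" by (auto intro: closed_subset finite_imp_closed)
      then show ?thesis using borel_Pi0_closed[of ?X] by (simp add: Suc)
    qed
  qed
  also have "(\<Union>k. A k) = takagi_S_inf"
  proof -
    have "y \<in> (\<Union>k. A k)" if "y \<in> takagi_S_inf" for y
    proof (cases "y \<in> G")
      case True
      then have "y \<in> A 0" by (simp add: A_def)
      then show ?thesis by blast
    next
      case False
      then have "y \<in> A (Suc (to_nat_on (takagi_S_inf - G) y))" using that by (simp add: A_def)
      then show ?thesis by blast
    qed
    moreover have "A k \<subseteq> takagi_S_inf" for k using G_sub by (cases k) (auto simp: A_def)
    ultimately show ?thesis by blast
  qed
  finally show ?thesis .
qed

theorem theorem4p2:
  shows "(\<forall>m::nat. nowhere_dense_in (top_of_set {0..2/3}) (takagi_S_le m))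
    \<and> residual_in (top_of_set {0..2/3}) takagi_S_inf
    \<and> borel_Delta0 (top_of_set {0..2/3}) 3 takagi_S_inf"
  unfolding borel_Delta0_def
  using takagi_S_le_nowhere_dense takagi_S_inf_residual takagi_S_inf_Pi0 takagi_S_inf_Sigma0 by blast

end
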